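(* There exists a quantum version of the vertex-insertion enumeration process for Hamiltonian cycles that generates the uniform superposition state of all Hamiltonian cycles within polynomial gate complexity. Precisely: there is a polynomial $p$ such that for every integer $N\ge 2$ there is a quantum circuit, acting on the $N\lceil\log_2 N\rceil$ qubits of the index registers together with some ancillary qubits, and consisting of at most $p(N)$ gates, which maps the all-zero state to $$\frac{1}{\sqrt{(N-1)!}}\sum_{\sigma\in\mathcal C(\{0,1,\dots,N-1\})}|\sigma(0)\rangle|\sigma(1)\rangle\cdots|\sigma(N-1)\rangle$$ (up to a global phase, with all ancillary qubits returned to $|0\rangle$), and which is a quantum version of the enumeration process, i.e. it first prepares the encoding of the unique Hamiltonian cycle on $\{N-2,N-1\}$ and then applies successive stages, one for each $k=N-2,N-3,\dots,1$, the stage for $k$ mapping, for every $\sigma\in\mathcal C(\{k,\dots,N-1\})$, $$|\sigma\rangle_k\;\longmapsto\;\frac{1}{\sqrt{N-k}}\sum_{j=k}^{N-1}|\mathrm{ins}(\sigma,j)\rangle_{k-1}$$ (up to a phase independent of $\sigma$, with ancillary qubits starting and ending in $|0\rangle$).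
   Context: Hamiltonian cycles. For a finite set $V$ with $|V|=n\ge2$, a Hamiltonian cycle (HC) of length $n$ on $V$ is a directed cycle in the complete graph on $V$ visiting every vertex exactly once. It is identified with the permutation $\sigma$ of $V$ where $\sigma(i)$ is the vertex visited immediately after $i$. $\mathcal C(V)$ denotes the set of HCs on $V$, i.e. the permutations of $V$ that are a single cycle of length $n$; $|\mathcal C(V)|=(n-1)!$. Encoding. Let $m=\lceil\log_2 N\rceil$. The index registers consist of $N$ sets of $m$ qubits, numbered $0,\dots,N-1$; a computational basis state of one set encodes an integer in binary. For $0\le k\le N-2$ and $\sigma\in\mathcal C(\{k,\dots,N-1\})$, $|\sigma\rangle_k$ denotes the basis state in which set $i$ holds $|\sigma(i)\rangle$ for $k\le i\le N-1$, and sets $0,\dots,k-1$ hold $|0\rangle$. Enumeration process. Start from the unique HC on $\{N-2,N-1\}$. Given an HC $\sigma$ on $\{k,\dots,N-1\}$ (with $1\le k\le N-2$), add the new element $k-1$, extending $\sigma$ by $k-1\mapsto k-1$, and then, for each $j\in\{k,\dots,N-1\}$, swap the value $k-1$ with the value $j$. The result, $\mathrm{ins}(\sigma,j)$, is the HC on $\{k-1,\dots,N-1\}$ given by $\mathrm{ins}(\sigma,j)(k-1)=j$, $\mathrm{ins}(\sigma,j)(\sigma^{-1}(j))=k-1$, and $\mathrm{ins}(\sigma,j)(i)=\sigma(i)$ for all other $i$. Equivalently, the edge $\sigma^{-1}(j)\to j$ is replaced by the path $\sigma^{-1}(j)\to (k-1)\to j$. Repeating this until vertex $0$ has been added yields the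 HCs on $\{0,\dots,N-1\}$. Gate complexity. This is the number of gates in the circuit, each gate counted as one, where the allowed gates are Hadamard gates $H$, single-qubit rotations $RZ(\theta)$ with arbitrary real angle (equivalently, up to global phase, phase gates), and multi-controlled NOT gates ($MCX$) with any number (including zero) of control qubits, each control being conditioned on either $|0\rangle$ or $|1\rangle$. *)

theory Defs
  imports Complex_Main "HOL-Combinatorics.Combinatorics" "HOL-Computational_Algebra.Polynomial"
begin

definition hamiltonian_cycles :: "nat set \<Rightarrow> (nat \<Rightarrow> nat) set" where
  "hamiltonian_cycles V = {\<sigma>. \<sigma> permutes V \<and> cyclic_on \<sigma> V}"

text \<open>The edge from \<open>inv \<sigma> j\<close> to \<open>j\<close> is replaced by the path through the new vertex \<open>v\<close>.\<close>

definition ins :: "(nat \<Rightarrow> nat) \<Rightarrow> nat \<Rightarrow> nat \<Rightarrow> nat \<Rightarrow> nat" where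
  "ins \<sigma> v j = \<sigma>(v := j, inv \<sigma> j := v)"

text \<open>Equivalently, \<open>\<sigma>\<close> is extended by the fixed point \<open>v\<close> and then the values \<open>v\<close> and \<open>j\<close> are
  swapped.\<close>

lemma ins_eq_transpose:
  assumes "\<sigma> permutes V" "v \<notin> V" "j \<in> V"
  shows "ins \<sigma> v j = transpose v j \<circ> \<sigma>"
proof
  fix i
  have "\<sigma> v = v" using assms(1,2) by (rule permutes_not_in)
  have *: "i = inv \<sigma> j \<longleftrightarrow> \<sigma> i = j" "i = v \<longleftrightarrow> \<sigma> i = v"
    using permutes_inverses[OF assms(1)] \<open>\<sigma> v = v\<close> by metis+
  show "ins \<sigma> v j i = (transpose v j \<circ> \<sigma>) i"
    using assms(2,3) * by (auto simp: ins_def transpose_def)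
qed

lemma hamiltonian_cycles_pair:
  assumes "a \<noteq> b"
  shows "hamiltonian_cycles {a, b} = {transpose a b}"
proof (intro equalityI subsetI)
  fix \<sigma> assume "\<sigma> \<in> hamiltonian_cycles {a, b}"
  then have p: "\<sigma> permutes {a, b}" and c: "cyclic_on \<sigma> {a, b}"
    by (auto simp: hamiltonian_cycles_def)
  have "\<sigma> a \<noteq> a"
  proof
    assume *: "\<sigma> a = a"
    have "orbit \<sigma> a = {a, b}" using c by (simp add: orbit_cyclic_eq3)
    moreover have "x = a" if "x \<in> orbit \<sigma> a" for x
      using that by induction (simp_all add: *)
    ultimately show False using assms by auto
  qed
  with p have "\<sigma> = transpose a b" by (simp add: permutes_doubleton_iff) auto
  then show "\<sigma> \<in> {transpose a b}" by simp
next
  fix \<sigma> assume "\<sigma> \<in> {transpose a b}"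
  moreover have "orbit (transpose a b) a = {a, b}"
  proof (intro equalityI subsetI)
    fix x assume "x \<in> orbit (transpose a b) a"
    then show "x \<in> {a, b}" by induction (auto simp: transpose_def)
  next
    have "b \<in> orbit (transpose a b) a" using orbit.base[of "transpose a b" a] by simp
    moreover from orbit.step[OF this] have "a \<in> orbit (transpose a b) a" by simp
    ultimately show "x \<in> orbit (transpose a b) a" if "x \<in> {a, b}" for x using that by auto
  qed
  ultimately show "\<sigma> \<in> hamiltonian_cycles {a, b}"
    unfolding hamiltonian_cycles_def cyclic_on_def
    by (auto intro: permutes_swap_id)
qed

text \<open>A computational basis state assigns a bit to each qubit, and a state vector assigns an
  amplitude to each computational basis state. An \<open>n\<close>-qubit register consists of the qubits
  \<open>0, \<dots>, n - 1\<close>; its states are those supported on assignments that are \<open>False\<close> from \<open>n\<close> on, and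
  circuits satisfying \<open>wf_circuit n\<close> below never touch any other qubit.\<close>

type_synonym bits = "nat \<Rightarrow> bool"
type_synonym qstate = "bits \<Rightarrow> complex"

definition ket :: "bits \<Rightarrow> qstate" where
  "ket x = (\<lambda>b. if b = x then 1 else 0)"

text \<open>\<open>MCX P Z t\<close> negates the target \<open>t\<close> when all qubits in \<open>P\<close> are 1 and all qubits in \<open>Z\<close> are 0.\<close>

datatype gate = H nat | RZ real nat | MCX "nat set" "nat set" nat

fun wf_gate :: "nat \<Rightarrow> gate \<Rightarrow> bool" where
  "wf_gate n (H q) \<longleftrightarrow> q < n"
| "wf_gate n (RZ \<theta> q) \<longleftrightarrow> q < n"
| "wf_gate n (MCX P Z t) \<longleftrightarrow> t < n \<and> P \<union> Z \<subseteq> {..<n} - {t} \<and> P \<inter> Z = {}"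

fun apply_gate :: "gate \<Rightarrow> qstate \<Rightarrow> qstate" where
  "apply_gate (H q) \<psi> =
     (\<lambda>b. (\<psi> (b(q := False)) + (if b q then - 1 else 1) * \<psi> (b(q := True))) / complex_of_real (sqrt 2))"
| "apply_gate (RZ \<theta> q) \<psi> = (\<lambda>b. (if b q then cis (\<theta> / 2) else cis (- \<theta> / 2)) * \<psi> b)"
| "apply_gate (MCX P Z t) \<psi> =
     (\<lambda>b. if (\<forall>q\<in>P. b q) \<and> (\<forall>q\<in>Z. \<not> b q) then \<psi> (b(t := \<not> b t)) else \<psi> b)"

text \<open>The head of the list is the gate applied first.\<close>

definition wf_circuit :: "nat \<Rightarrow> gate list \<Rightarrow> bool" where
  "wf_circuit n gs \<longleftrightarrow> (\<forall>g\<in>set gs. wf_gate n g)"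

definition run :: "gate list \<Rightarrow> qstate \<Rightarrow> qstate" where
  "run gs \<psi> = fold apply_gate gs \<psi>"

definition idx_width :: "nat \<Rightarrow> nat" where
  "idx_width N = nat \<lceil>log 2 (real N)\<rceil>"

text \<open>Bit \<open>l\<close> (little-endian) of index set \<open>i\<close> is qubit \<open>i * idx_width N + l\<close>. The index registers
  occupy the qubits below \<open>N * idx_width N\<close>; all later qubits are ancillary and are 0 in an
  encoding, as are the index sets below \<open>k\<close>.\<close>

definition enc :: "nat \<Rightarrow> nat \<Rightarrow> (nat \<Rightarrow> nat) \<Rightarrow> bits" where
  "enc N k \<sigma> = (\<lambda>q. let m = idx_width N; i = q div m; l = q mod m
                    in k \<le> i \<and> q < N * m \<and> bit (\<sigma> i) l)"

end

theory Submission imports Defs begin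

text \<open>One ancilla suffices. Stage \<open>k\<close> first writes a uniform superposition of the \<open>j \<in> {k..<N}\<close> into
  the empty register \<open>k - 1\<close>: the values are offered one after the other, and an undecided branch
  accepts \<open>j\<close> with probability \<open>1 / (N - j)\<close> by a controlled rotation of the ancilla, which is
  afterwards reset by comparing register \<open>k - 1\<close> with \<open>j\<close>. Then, for all \<open>i, j \<in> {k..<N}\<close>, if
  registers \<open>k - 1\<close> and \<open>i\<close> both hold \<open>j\<close>, register \<open>i\<close> is overwritten by \<open>k - 1\<close>. Since insertion is
  a bijection from pairs (cycle, edge) to cycles on one more vertex, no amplitudes are merged and
  uniformity is preserved.\<close>

section \<open>Hamiltonian cycles\<close>

lemma orbit_subset_invariant:
  assumes "f ` A \<subseteq> A" "x \<in> A"
  shows "orbit f x \<subseteq> A"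
proof
  fix y assume "y \<in> orbit f x"
  then show "y \<in> A" by induction (use assms in auto)
qed

text \<open>An orbit is the least invariant set reached from its point, so cyclicity means having no
  proper nonempty invariant subset. In this form it passes through insertion by adding or deleting
  \<open>v\<close>.\<close>

lemma hamiltonian_cycles_iff:
  assumes "finite V"
  shows "\<sigma> \<in> hamiltonian_cycles V \<longleftrightarrow>
    \<sigma> permutes V \<and> V \<noteq> {} \<and> (\<forall>A. A \<noteq> {} \<and> A \<subseteq> V \<and> \<sigma> ` A \<subseteq> A \<longrightarrow> A = V)"
proof (cases "\<sigma> permutes V")
  case True
  have "cyclic_on \<sigma> V \<longleftrightarrow> V \<noteq> {} \<and> (\<forall>A. A \<noteq> {} \<and> A \<subseteq> V \<and> \<sigma> ` A \<subseteq> A \<longrightarrow> A = V)"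
  proof
    assume c: "cyclic_on \<sigma> V"
    show "V \<noteq> {} \<and> (\<forall>A. A \<noteq> {} \<and> A \<subseteq> V \<and> \<sigma> ` A \<subseteq> A \<longrightarrow> A = V)"
    proof (intro conjI allI impI)
      show "V \<noteq> {}" using c by (auto simp: cyclic_on_def)
      fix A assume A: "A \<noteq> {} \<and> A \<subseteq> V \<and> \<sigma> ` A \<subseteq> A"
      then obtain x where x: "x \<in> A" by auto
      then have "orbit \<sigma> x = V" using A c by (intro orbit_cyclic_eq3) auto
      with orbit_subset_invariant[of \<sigma> A x] A x show "A = V" by auto
    qed
  next
    assume min: "V \<noteq> {} \<and> (\<forall>A. A \<noteq> {} \<and> A \<subseteq> V \<and> \<sigma> ` A \<subseteq> A \<longrightarrow> A = V)"
    then obtain x where x: "x \<in> V" by auto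
    have "orbit \<sigma> x \<noteq> {}" using orbit.base[of \<sigma> x] by auto
    moreover have "orbit \<sigma> x \<subseteq> V"
      using x True by (intro orbit_subset_invariant) (auto simp: permutes_image)
    moreover have "\<sigma> ` orbit \<sigma> x \<subseteq> orbit \<sigma> x" by (auto intro: orbit.step)
    ultimately show "cyclic_on \<sigma> V" using min x by (auto simp: cyclic_on_def)
  qed
  then show ?thesis using True by (simp add: hamiltonian_cycles_def)
qed (simp add: hamiltonian_cycles_def)

text \<open>An invariant set of the new map, minus \<open>v\<close>, is nonempty and
  \<open>\<sigma>\<close>-invariant, hence all of \<open>V\<close>; the predecessor of
  \<open>j\<close> then forces \<open>v\<close> in as well.\<close>

lemma ins_hamiltonian_cycle:
  assumes "finite V" "v \<notin> V" "\<sigma> \<in> hamiltonian_cycles V" "j \<in> V"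
  shows "ins \<sigma> v j \<in> hamiltonian_cycles (insert v V)"
proof -
  have p: "\<sigma> permutes V"
    and min: "\<And>A. A \<noteq> {} \<Longrightarrow> A \<subseteq> V \<Longrightarrow> \<sigma> ` A \<subseteq> A \<Longrightarrow> A = V"
    using assms(1,3) by (auto simp: hamiltonian_cycles_iff)
  have eq: "ins \<sigma> v j = transpose v j \<circ> \<sigma>" by (rule ins_eq_transpose[OF p assms(2,4)])
  have fix_v: "\<sigma> v = v" using p assms(2) by (rule permutes_not_in)
  have "ins \<sigma> v j permutes insert v V"
    unfolding eq using p assms(4)
    by (intro permutes_compose[OF permutes_subset[OF p]] permutes_swap_id) auto
  moreover have "A = insert v V"
    if A: "A \<noteq> {}" "A \<subseteq> insert v V" and inv: "ins \<sigma> v j ` A \<subseteq> A" for A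
  proof -
    have step: "transpose v j (\<sigma> x) \<in> A" if "x \<in> A" for x
      using inv that by (auto simp: eq)
    have v_step: "j \<in> A" if "v \<in> A" using step[OF that] fix_v by simp
    have "A - {v} \<noteq> {}" using A v_step assms(2,4) by auto
    moreover have "\<sigma> ` (A - {v}) \<subseteq> A - {v}"
    proof
      fix y assume "y \<in> \<sigma> ` (A - {v})"
      then obtain x where x: "x \<in> A" "x \<noteq> v" "y = \<sigma> x" by auto
      then have "x \<in> V" using A by auto
      then have "y \<in> V" using x p by (simp add: permutes_in_image)
      then have "y \<noteq> v" using assms(2) by auto
      then show "y \<in> A - {v}"
        using step[OF x(1)] v_step x(3) by (cases "y = j") auto
    qed
    moreover have "A - {v} \<subseteq> V" using A by auto
    ultimately have V: "A - {v} = V" using min by simp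
    have "inv \<sigma> j \<in> V" using p assms(4) by (simp add: permutes_in_image permutes_inv)
    then have "transpose v j (\<sigma> (inv \<sigma> j)) \<in> A" using V by (intro step) auto
    then have "v \<in> A" using permutes_inverses[OF p] by simp
    with V show ?thesis by auto
  qed
  ultimately show ?thesis using assms(1) by (auto simp: hamiltonian_cycles_iff)
qed

text \<open>Contracting \<open>v\<close> recovers the smaller cycle: with \<open>j\<close> the
  successor of \<open>v\<close>, composing with the transposition makes \<open>v\<close> a fixed
  point.\<close>

lemma hamiltonian_cycle_is_ins:
  assumes "finite V" "v \<notin> V" "V \<noteq> {}" "\<tau> \<in> hamiltonian_cycles (insert v V)"
  shows "\<exists>\<sigma>\<in>hamiltonian_cycles V. \<exists>j\<in>V. \<tau> = ins \<sigma> v j"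
proof -
  have p: "\<tau> permutes insert v V"
    and min: "\<And>A. A \<noteq> {} \<Longrightarrow> A \<subseteq> insert v V \<Longrightarrow> \<tau> ` A \<subseteq> A \<Longrightarrow> A = insert v V"
    using assms(1,4) by (auto simp: hamiltonian_cycles_iff)
  define j where "j = \<tau> v"
  have "j \<noteq> v" using min[of "{v}"] assms(2,3) by (auto simp: j_def)
  moreover have "j \<in> insert v V" using permutes_in_image[OF p, of v] by (simp add: j_def)
  ultimately have j: "j \<in> V" by auto
  define \<sigma> where "\<sigma> = transpose v j \<circ> \<tau>"
  have "\<sigma> permutes insert v V"
    unfolding \<sigma>_def using j by (intro permutes_compose[OF p] permutes_swap_id) auto
  moreover have "\<sigma> v = v" by (simp add: \<sigma>_def j_def)
  ultimately have p': "\<sigma> permutes V"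
    by (auto intro: permutes_superset)
  have \<tau>: "\<tau> = transpose v j \<circ> \<sigma>" by (simp add: \<sigma>_def fun_eq_iff)
  \<comment> \<open>If \<open>\<sigma>\<close> maps some point of \<open>A\<close> to
    \<open>j\<close>, adding \<open>v\<close> makes \<open>A\<close> invariant under
    \<open>\<tau>\<close>. Otherwise \<open>A\<close> itself is invariant under
    \<open>\<tau>\<close>, a contradiction as \<open>v\<close> is missing.\<close>
  have "A = V" if A: "A \<noteq> {}" "A \<subseteq> V" and inv: "\<sigma> ` A \<subseteq> A" for A
  proof (cases "j \<in> \<sigma> ` A")
    case True
    then have "j \<in> A" using inv by blast
    moreover have "\<tau> x \<in> insert v A" if "x \<in> A" for x
    proof -
      have "\<sigma> x \<in> A" using inv that by blast
      then show ?thesis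
        using \<open>j \<in> A\<close> fun_cong[OF \<tau>, of x] by (auto simp: transpose_def)
    qed
    ultimately have "\<tau> ` insert v A \<subseteq> insert v A" by (auto simp flip: j_def)
    then have "insert v A = insert v V" using A by (intro min) auto
    then show ?thesis using A assms(2) by auto
  next
    case False
    have "\<tau> x = \<sigma> x" if "x \<in> A" for x
      using that False inv A assms(2) by (auto simp: \<tau> transpose_def)
    then have "A = insert v V" using A inv by (intro min) auto
    then show ?thesis using A assms(2) by auto
  qed
  then have "\<sigma> \<in> hamiltonian_cycles V"
    using p' assms(1,3) by (auto simp: hamiltonian_cycles_iff)
  moreover have "\<tau> = ins \<sigma> v j" using ins_eq_transpose[OF p' assms(2) j] \<tau> by simp
  ultimately show ?thesis using j by blast
qed

text \<open>The value at \<open>v\<close> reveals \<open>j\<close>, and undoing the transposition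
  then reveals \<open>\<sigma>\<close>.\<close>

lemma bij_betw_ins:
  assumes "finite V" "v \<notin> V" "V \<noteq> {}"
  shows "bij_betw (\<lambda>(\<sigma>, j). ins \<sigma> v j) (hamiltonian_cycles V \<times> V) (hamiltonian_cycles (insert v V))"
proof (rule bij_betw_imageI)
  show "inj_on (\<lambda>(\<sigma>, j). ins \<sigma> v j) (hamiltonian_cycles V \<times> V)"
  proof (rule inj_onI, clarify)
    fix \<sigma> j \<sigma>' j'
    assume "\<sigma> \<in> hamiltonian_cycles V" "\<sigma>' \<in> hamiltonian_cycles V"
      and j: "j \<in> V" "j' \<in> V" and eq: "ins \<sigma> v j = ins \<sigma>' v j'"
    then have p: "\<sigma> permutes V" "\<sigma>' permutes V" by (auto simp: hamiltonian_cycles_def)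
    have e: "transpose v j \<circ> \<sigma> = transpose v j' \<circ> \<sigma>'"
      using eq j p assms(2) by (simp add: ins_eq_transpose)
    from fun_cong[OF this, of v] have "j = j'"
      using p assms(2) by (simp add: permutes_not_in)
    moreover from this e have "\<sigma> = \<sigma>'"
      by (metis comp_assoc transpose_comp_involutory comp_id id_comp)
    ultimately show "\<sigma> = \<sigma>' \<and> j = j'" by simp
  qed
  show "(\<lambda>(\<sigma>, j). ins \<sigma> v j) ` (hamiltonian_cycles V \<times> V) = hamiltonian_cycles (insert v V)"
    using ins_hamiltonian_cycle[OF assms(1,2)] hamiltonian_cycle_is_ins[OF assms] by fastforce
qed

section \<open>Running circuits\<close>

lemma run_simps [simp]:
  "run [] \<psi> = \<psi>" "run (g # gs) \<psi> = run gs (apply_gate g \<psi>)"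
  "run (gs @ hs) \<psi> = run hs (run gs \<psi>)"
  by (simp_all add: run_def)

section \<open>Linearity of circuits\<close>

lemma apply_gate_lincomb:
  "apply_gate g (\<lambda>b. c * \<phi> b + \<psi> b) = (\<lambda>b. c * apply_gate g \<phi> b + apply_gate g \<psi> b)"
  by (cases g) (auto simp: field_simps)

lemma run_lincomb: "run gs (\<lambda>b. c * \<phi> b + \<psi> b) = (\<lambda>b. c * run gs \<phi> b + run gs \<psi> b)"
  by (induction gs arbitrary: \<phi> \<psi>) (simp_all add: apply_gate_lincomb)

lemma run_zero: "run gs (\<lambda>b. 0) = (\<lambda>b. 0)"
  \<comment> \<open>With coefficient \<open>-1\<close> and both vectors zero, the right-hand side
    cancels.\<close>
  using run_lincomb[of gs "-1" "\<lambda>b. 0" "\<lambda>b. 0"] by (simp add: fun_eq_iff)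

lemma run_scale: "run gs (\<lambda>b. c * \<phi> b) = (\<lambda>b. c * run gs \<phi> b)"
  using run_lincomb[of gs c \<phi> "\<lambda>b. 0"] by (simp add: run_zero)

lemma run_sum: "run gs (\<lambda>b. \<Sum>i\<in>I. \<psi> i b) = (\<lambda>b. \<Sum>i\<in>I. run gs (\<psi> i) b)"
proof (induction I rule: infinite_finite_induct)
  case (insert i I)
  then show ?case using run_lincomb[of gs 1 "\<psi> i" "\<lambda>b. \<Sum>i\<in>I. \<psi> i b"] by simp
qed (simp_all add: run_zero)

text \<open>Amplitudes are transformed by precomposition; as the target is not a control, the map on
  assignments is an involution and therefore also moves the basis state.\<close>

lemma apply_MCX_ket:
  assumes "t \<notin> P" "t \<notin> Z"
  shows "apply_gate (MCX P Z t) (ket x) =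
    ket (if (\<forall>q\<in>P. x q) \<and> (\<forall>q\<in>Z. \<not> x q) then x(t := \<not> x t) else x)"
proof
  fix b :: bits
  show "apply_gate (MCX P Z t) (ket x) b =
    ket (if (\<forall>q\<in>P. x q) \<and> (\<forall>q\<in>Z. \<not> x q) then x(t := \<not> x t) else x) b"
  \<comment> \<open>Off the target, \<open>b\<close> either agrees with \<open>x\<close>, so that
    the controls read alike, or every term vanishes.\<close>
  proof (cases "\<forall>q. q \<noteq> t \<longrightarrow> b q = x q")
    case True
    then have "(\<forall>q\<in>P. b q) = (\<forall>q\<in>P. x q)" "(\<forall>q\<in>Z. \<not> b q) = (\<forall>q\<in>Z. \<not> x q)"
      using assms by metis+
    moreover have "(b(t := \<not> b t) = x) = (b = x(t := \<not> x t))"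
      using True by (auto simp: fun_eq_iff)
    ultimately show ?thesis by (simp add: ket_def)
  next
    case False
    then have "b \<noteq> x" "b(t := \<not> b t) \<noteq> x" "b \<noteq> x(t := \<not> x t)" by auto
    then show ?thesis by (simp add: ket_def)
  qed
qed

text \<open>No target is a control, so the condition is constant along the list; distinctness lets
  no target flip twice.\<close>

lemma run_MCX_family_ket:
  assumes "distinct qs" "set qs \<inter> C = {}"
  shows "run (map (MCX C {}) qs) (ket x) =
    ket (\<lambda>q. if q \<in> set qs \<and> (\<forall>c\<in>C. x c) then \<not> x q else x q)"
  using assms
proof (induction qs arbitrary: x)
  case (Cons a qs)
  let ?y = "if \<forall>c\<in>C. x c then x(a := \<not> x a) else x"
  have "(\<forall>c\<in>C. ?y c) = (\<forall>c\<in>C. x c)" using Cons.prems by auto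
  moreover have "run (map (MCX C {}) (a # qs)) (ket x) =
      ket (\<lambda>q. if q \<in> set qs \<and> (\<forall>c\<in>C. ?y c) then \<not> ?y q else ?y q)"
    using Cons by (simp add: apply_MCX_ket del: apply_gate.simps)
  ultimately show ?case using Cons.prems by (auto intro!: arg_cong[of _ _ ket])
qed simp

text \<open>Conjugation by \<open>H\<close> turns \<open>RZ (2 * \<alpha>)\<close> into the
  X-rotation with entries \<open>cos \<alpha>\<close> on the diagonal and
  \<open>- \<i> * sin \<alpha>\<close> off it.\<close>

definition ctrl_rx :: "nat set \<Rightarrow> nat \<Rightarrow> real \<Rightarrow> gate list" where
  "ctrl_rx Z t \<alpha> = [H t, RZ \<alpha> t, MCX {} Z t, RZ (- \<alpha>) t, MCX {} Z t, H t]"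

text \<open>Where the control holds, \<open>X\<close> conjugates \<open>RZ (- \<alpha>)\<close> to \<open>RZ \<alpha>\<close>, so the two rotations add up
  to \<open>RZ (2 * \<alpha>)\<close>; elsewhere they cancel.\<close>

lemma run_ctrl_rx_ket:
  assumes "t \<notin> Z" "\<not> x t"
  shows "run (ctrl_rx Z t \<alpha>) (ket x) =
    (if \<forall>q\<in>Z. \<not> x q
     then \<lambda>b. complex_of_real (cos \<alpha>) * ket x b +
       (- \<i> * complex_of_real (sin \<alpha>)) * ket (x(t := True)) b
     else ket x)"
proof
  fix b :: bits
  have r2: "complex_of_real (sqrt 2) * complex_of_real (sqrt 2) = 2"
    by (simp flip: of_real_mult)
  then have r2': "2 / complex_of_real (sqrt 2) = sqrt 2" by (simp add: divide_eq_eq)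
  have "b(t := True) \<noteq> x" using assms(2) by auto
  then have kT: "ket x (b(t := True)) = 0" by (simp add: ket_def)
  have Z: "(\<forall>q\<in>Z. \<not> (if q = t then u else b q)) = (\<forall>q\<in>Z. \<not> b q)" for u
    using assms(1) by metis
  have C: "cis (\<alpha>/2) * cis (\<alpha>/2) = cis \<alpha>" "cis (-(\<alpha>/2)) * cis (-(\<alpha>/2)) = cis (-\<alpha>)"
    "cis (\<alpha>/2) * cis (-(\<alpha>/2)) = 1" "cis (-(\<alpha>/2)) * cis (\<alpha>/2) = 1"
    by (simp_all add: cis_mult)
  have cs: "cis (-\<alpha>) + cis \<alpha> = 2 * complex_of_real (cos \<alpha>)"
    "cis (-\<alpha>) - cis \<alpha> = - (2 * \<i> * complex_of_real (sin \<alpha>))"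
    by (simp_all add: complex_eq_iff)
  show "run (ctrl_rx Z t \<alpha>) (ket x) b = (if \<forall>q\<in>Z. \<not> x q
     then \<lambda>b. complex_of_real (cos \<alpha>) * ket x b +
       (- \<i> * complex_of_real (sin \<alpha>)) * ket (x(t := True)) b
     else ket x) b"
  \<comment> \<open>The gates mix only assignments differing at \<open>t\<close>. As
    \<open>x t\<close> is false, the test asks whether \<open>b\<close> agrees with \<open>x\<close>
    elsewhere.\<close>
  proof (cases "b(t := False) = x")
    case True
    have "x q = b q" if "q \<in> Z" for q using True[symmetric] that assms(1) by auto
    then have bZ: "(\<forall>q\<in>Z. \<not> b q) = (\<forall>q\<in>Z. \<not> x q)" by blast
    have kF: "ket x (b(t := False)) = 1" using True by (simp add: ket_def)
    have k: "ket x b = (if b t then 0 else 1)" "ket (x(t := True)) b = (if b t then 1 else 0)"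
      using True[symmetric] by (auto simp: ket_def fun_eq_iff)
    show ?thesis
      by (simp add: ctrl_rx_def Z bZ kT kF k C cs r2 r2' flip: add_divide_distrib diff_divide_distrib)
  next
    case False
    then have "b \<noteq> x" "b \<noteq> x(t := True)" using assms(2) by (auto simp: fun_upd_idem)
    then show ?thesis using False kT Z by (simp add: ctrl_rx_def ket_def)
  qed
qed

section \<open>Index registers\<close>

text \<open>Qubit \<open>N * m\<close> is the single ancilla, with value \<open>t\<close>; only the
  low \<open>m\<close> bits of each \<open>W i\<close> are stored.\<close>

definition basis :: "nat \<Rightarrow> nat \<Rightarrow> (nat \<Rightarrow> nat) \<Rightarrow> bool \<Rightarrow> bits" where
  "basis N m W t = (\<lambda>q. if q < N * m then bit (W (q div m)) (q mod m) else q = N * m \<and> t)"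

text \<open>Together with \<open>zeros\<close>, these are the controls of an \<open>MCX\<close>
  testing whether register \<open>i\<close> holds \<open>w\<close>.\<close>

definition ones :: "nat \<Rightarrow> nat \<Rightarrow> nat \<Rightarrow> nat set" where
  "ones m i w = (\<lambda>l. i * m + l) ` {l. l < m \<and> bit w l}"

definition zeros :: "nat \<Rightarrow> nat \<Rightarrow> nat \<Rightarrow> nat set" where
  "zeros m i w = (\<lambda>l. i * m + l) ` {l. l < m \<and> \<not> bit w l}"

lemma qubit_less:
  assumes "i < N" "l < m"
  shows "i * m + l < N * (m :: nat)"
proof -
  have "i * m + l < Suc i * m" using assms(2) by simp
  also have "\<dots> \<le> N * m" using assms(1) by (intro mult_le_mono1) simp
  finally show ?thesis .
qed

lemma ones_zeros_less:
  assumes "i < N" "q \<in> ones m i w \<union> zeros m i w"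
  shows "q < N * m"
  using assms by (auto simp: ones_def zeros_def qubit_less)

lemma basis_qubit:
  assumes "i < N" "l < m"
  shows "basis N m W t (i * m + l) = bit (W i) l"
  using qubit_less[OF assms] assms(2) by (simp add: basis_def)

lemma nat_eq_iff_bits_below:
  fixes x y :: nat
  assumes "x < 2 ^ m" "y < 2 ^ m"
  shows "x = y \<longleftrightarrow> (\<forall>l<m. bit x l = bit y l)"
proof
  assume "\<forall>l<m. bit x l = bit y l"
  then have "take_bit m x = take_bit m y" by (auto simp: bit_eq_iff bit_take_bit_iff)
  then show "x = y" using assms by (simp add: take_bit_nat_eq_self)
qed simp

text \<open>The controls cover all \<open>m\<close> bits, and these determine numbers below
  \<open>2 ^ m\<close>.\<close>

lemma basis_matches_iff:
  assumes "i < N" "W i < 2 ^ m" "w < 2 ^ m"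
  shows "(\<forall>q\<in>ones m i w. basis N m W t q) \<and> (\<forall>q\<in>zeros m i w. \<not> basis N m W t q) \<longleftrightarrow> W i = w"
  using assms nat_eq_iff_bits_below[OF assms(2,3)]
  by (auto simp: ones_def zeros_def basis_qubit)

lemma basis_flip_ancilla: "(basis N m W t)(N * m := u) = basis N m W u"
  by (auto simp: basis_def fun_eq_iff)

text \<open>Overwriting must be reversible, hence XOR: it writes \<open>w\<close> into an empty
  register, and exchanges two values whose XOR is \<open>w\<close>.\<close>

definition xor_reg :: "nat \<Rightarrow> nat \<Rightarrow> nat \<Rightarrow> nat \<Rightarrow> gate list" where
  "xor_reg N m i w = map (MCX {N * m} {}) (map (\<lambda>l. i * m + l) (filter (bit w) [0..<m]))"

lemma run_xor_reg:
  assumes "i < N"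
  shows "run (xor_reg N m i w) (ket (basis N m W t)) =
    ket (basis N m (if t then W(i := xor (W i) (take_bit m w)) else W) t)"
proof -
  let ?qs = "map (\<lambda>l. i * m + l) (filter (bit w) [0..<m])"
  have "distinct ?qs" by (auto simp: distinct_map inj_on_def)
  moreover have "set ?qs \<inter> {N * m} = {}" using qubit_less[OF assms] by fastforce
  moreover have t: "(\<forall>c\<in>{N * m}. basis N m W t c) = t" by (simp add: basis_def)
  ultimately have "run (xor_reg N m i w) (ket (basis N m W t)) =
      ket (\<lambda>q. if q \<in> set ?qs \<and> t then \<not> basis N m W t q else basis N m W t q)"
    unfolding xor_reg_def by (simp only: run_MCX_family_ket t)
  moreover have "(if q \<in> set ?qs \<and> t then \<not> basis N m W t q else basis N m W t q) =
      basis N m (if t then W(i := xor (W i) (take_bit m w)) else W) t q" for q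
  proof (cases "q < N * m")
    case True
    then have m: "m > 0" by (cases m) auto
    have "q \<in> set ?qs \<longleftrightarrow> q div m = i \<and> bit w (q mod m)"
    proof
      assume "q div m = i \<and> bit w (q mod m)"
      then show "q \<in> set ?qs" using m by (auto simp: image_iff intro!: exI[of _ "q mod m"])
    qed (use m in auto)
    then show ?thesis using True m
      by (simp add: basis_def bit_xor_iff bit_take_bit_iff)
  next
    case False
    then have "q \<notin> set ?qs" using qubit_less[OF assms] by auto
    then show ?thesis using False by (simp add: basis_def)
  qed
  ultimately show ?thesis by presburger
qed


lemma basis_cong: "(\<And>i. i < N \<Longrightarrow> W i = W' i) \<Longrightarrow> basis N m W t = basis N m W' t"
  by (auto simp: basis_def fun_eq_iff less_mult_imp_div_less)

lemma apply_MCX_ancilla: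
  assumes "\<And>q. q \<in> P \<union> Z \<Longrightarrow> q < N * m"
  shows "apply_gate (MCX P Z (N * m)) (ket (basis N m W t)) =
    ket (basis N m W (if (\<forall>q\<in>P. basis N m W t q) \<and> (\<forall>q\<in>Z. \<not> basis N m W t q) then \<not> t else t))"
proof -
  have "N * m \<notin> P" "N * m \<notin> Z" using assms by blast+
  moreover have "basis N m W t (N * m) = t" by (simp add: basis_def)
  ultimately show ?thesis
    by (simp add: apply_MCX_ket basis_flip_ancilla del: apply_gate.simps)
qed

lemma apply_MCX_match:
  assumes "i < N" "W i < 2 ^ m" "w < 2 ^ m"
  shows "apply_gate (MCX (ones m i w) (zeros m i w) (N * m)) (ket (basis N m W t)) =
    ket (basis N m W (if W i = w then \<not> t else t))"
  using ones_zeros_less[OF assms(1)] basis_matches_iff[of i N W m w t, OF assms]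
  by (subst apply_MCX_ancilla) auto

lemma apply_MCX_match2:
  assumes "i < N" "W i < 2 ^ m" "w < 2 ^ m" "i' < N" "W i' < 2 ^ m" "w' < 2 ^ m"
  shows "apply_gate (MCX (ones m i w \<union> ones m i' w') (zeros m i w \<union> zeros m i' w') (N * m))
      (ket (basis N m W t)) =
    ket (basis N m W (if W i = w \<and> W i' = w' then \<not> t else t))"
proof -
  have less: "q < N * m"
    if "q \<in> (ones m i w \<union> ones m i' w') \<union> (zeros m i w \<union> zeros m i' w')" for q
    using ones_zeros_less[OF assms(1)] ones_zeros_less[OF assms(4)] that by blast
  have "(\<forall>q\<in>ones m i w \<union> ones m i' w'. basis N m W t q) \<and>
      (\<forall>q\<in>zeros m i w \<union> zeros m i' w'. \<not> basis N m W t q) \<longleftrightarrow> W i = w \<and> W i' = w'"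
    unfolding ball_Un
    using basis_matches_iff[of i N W m w t, OF assms(1-3)]
      basis_matches_iff[of i' N W m w' t, OF assms(4-6)] by blast
  then show ?thesis by (simp only: apply_MCX_ancilla[OF less])
qed

section \<open>Uniform superposition of the inserted index\<close>

text \<open>A zero in register \<open>v\<close> means that no value has been picked yet. Every branch takes the sine
  term of exactly one rotation, so its phase \<open>- \<i>\<close> is common to all branches.\<close>

definition pick :: "nat \<Rightarrow> nat \<Rightarrow> nat \<Rightarrow> nat \<Rightarrow> real \<Rightarrow> gate list" where
  "pick N m v j \<alpha> = ctrl_rx (zeros m v 0) (N * m) \<alpha> @ xor_reg N m v j @
     [MCX (ones m v j) (zeros m v j) (N * m)]"

lemma run_ctrl_rx_basis:
  assumes "v < N" "W v < 2 ^ m"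
  shows "run (ctrl_rx (zeros m v 0) (N * m) \<alpha>) (ket (basis N m W False)) =
    (if W v = 0
     then \<lambda>b. complex_of_real (cos \<alpha>) * ket (basis N m W False) b +
        (- \<i> * complex_of_real (sin \<alpha>)) * ket (basis N m W True) b
     else ket (basis N m W False))"
proof -
  have "N * m \<notin> zeros m v 0" using ones_zeros_less[OF assms(1)] by blast
  moreover have "\<not> basis N m W False (N * m)" by (simp add: basis_def)
  \<comment> \<open>\<open>ones m v 0\<close> is empty, so zero controls alone test for an empty
    register.\<close>
  moreover have "(\<forall>q\<in>zeros m v 0. \<not> basis N m W False q) = (W v = 0)"
    using basis_matches_iff[where w = 0 and t = False, of v N W m] assms by (simp add: ones_def)
  ultimately show ?thesis by (subst run_ctrl_rx_ket) (simp_all only: basis_flip_ancilla not_False_eq_True)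
qed

text \<open>The ancilla flags acceptance; the register then holds \<open>j\<close>, so the
  comparison clears the flag. As \<open>0 < j\<close>, the refused branch is left alone.\<close>

lemma run_pick:
  assumes "v < N" "W v = 0" "0 < j" "j < 2 ^ m"
  shows "run (pick N m v j \<alpha>) (ket (basis N m W False)) =
    (\<lambda>b. complex_of_real (cos \<alpha>) * ket (basis N m W False) b +
        (- \<i> * complex_of_real (sin \<alpha>)) * ket (basis N m (W(v := j)) False) b)"
proof -
  let ?gs = "xor_reg N m v j @ [MCX (ones m v j) (zeros m v j) (N * m)]"
  have "run ?gs (ket (basis N m W False)) = ket (basis N m W False)"
    using assms by (simp add: run_xor_reg apply_MCX_match del: apply_gate.simps)
  moreover have "run ?gs (ket (basis N m W True)) = ket (basis N m (W(v := j)) False)"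
    using assms by (simp add: run_xor_reg apply_MCX_match take_bit_nat_eq_self del: apply_gate.simps)
  moreover have "run (pick N m v j \<alpha>) (ket (basis N m W False)) = run ?gs
      (\<lambda>b. complex_of_real (cos \<alpha>) * ket (basis N m W False) b +
        (- \<i> * complex_of_real (sin \<alpha>)) * ket (basis N m W True) b)"
    unfolding pick_def using assms
    by (simp only: run_simps(3) run_ctrl_rx_basis) (simp del: apply_gate.simps)
  ultimately show ?thesis by (simp only: run_lincomb run_scale)
qed

text \<open>A nonzero register blocks the rotation, and one different from \<open>j\<close> is not
  flagged by the closing comparison.\<close>

lemma run_pick_idle:
  assumes "v < N" "W v < 2 ^ m" "W v \<noteq> 0" "W v \<noteq> j" "j < 2 ^ m"
  shows "run (pick N m v j \<alpha>) (ket (basis N m W False)) = ket (basis N m W False)"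
  using assms
  by (simp add: pick_def run_ctrl_rx_basis run_xor_reg apply_MCX_match del: apply_gate.simps)

text \<open>The free end \<open>n\<close> serves the induction. For \<open>j = N - 1\<close> the
  angle is \<open>arcsin 1\<close>, so no branch stays undecided.\<close>

definition prep :: "nat \<Rightarrow> nat \<Rightarrow> nat \<Rightarrow> nat \<Rightarrow> nat \<Rightarrow> gate list" where
  "prep N m v k n = concat (map (\<lambda>j. pick N m v j (arcsin (1 / sqrt (N - j)))) [k..<n])"

text \<open>The refusal probabilities \<open>(N - j - 1) / (N - j)\<close> telescope to the weight
  \<open>(N - n) / (N - k)\<close> of the undecided branch.\<close>

lemma run_prep_partial:
  assumes "v < N" "W v = 0" "0 < k" "k \<le> n" "n \<le> N" "k < N" "N \<le> 2 ^ m"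
  shows "run (prep N m v k n) (ket (basis N m W False)) =
    (\<lambda>b. complex_of_real (sqrt (real (N - n) / real (N - k))) * ket (basis N m W False) b +
      (\<Sum>j\<in>{k..<n}. (- \<i> / complex_of_real (sqrt (real (N - k)))) *
         ket (basis N m (W(v := j)) False) b))"
  using assms(4,5)
proof (induction n rule: dec_induct)
  case base
  then show ?case using assms(6) by (simp add: prep_def)
next
  case (step n)
  define r where "r = real (N - n)"
  define d where "d = real (N - k)"
  have n: "n < N" "0 < n" using step assms(3) by auto
  have r: "r \<ge> 1" "d > 0" using n assms(6) by (auto simp: r_def d_def)
  have r1: "real (N - Suc n) = r - 1" using n by (simp add: r_def of_nat_diff)
  let ?\<alpha> = "arcsin (1 / sqrt r)"
  let ?K = "\<lambda>j. ket (basis N m (W(v := j)) False)"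
  let ?c = "- \<i> / complex_of_real (sqrt d)"
  have "1 / sqrt r \<le> 1" "- 1 \<le> 1 / sqrt r" using r by (auto intro: order.trans[of _ 0])
  then have sin: "sin ?\<alpha> = 1 / sqrt r" and cos: "cos ?\<alpha> = sqrt ((r - 1) / r)"
    using r by (simp_all add: cos_arcsin power_divide diff_divide_distrib)
  have "sqrt (r / d) * cos ?\<alpha> = sqrt ((r - 1) / d)"
    unfolding cos using r by (simp flip: real_sqrt_mult)
  then have c1: "complex_of_real (sqrt (r / d)) * complex_of_real (cos ?\<alpha>) = complex_of_real (sqrt ((r - 1) / d))"
    by (simp flip: of_real_mult)
  \<comment> \<open>Acceptance cancels \<open>r\<close>, so every value gets the same
    amplitude.\<close>
  have "sqrt (r / d) * sin ?\<alpha> = 1 / sqrt d"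
    unfolding sin using r by (simp add: real_sqrt_divide)
  then have "complex_of_real (sqrt (r / d)) * complex_of_real (sin ?\<alpha>) = 1 / complex_of_real (sqrt d)"
    by (simp flip: of_real_mult)
  then have c2: "complex_of_real (sqrt (r / d)) * (- \<i> * complex_of_real (sin ?\<alpha>)) = ?c"
    by (simp add: mult.left_commute)
  \<comment> \<open>Values picked earlier differ from \<open>n\<close> and are nonzero because
    \<open>0 < k\<close>.\<close>
  have idle: "run (pick N m v n ?\<alpha>) (?K j) = ?K j" if "j \<in> {k..<n}" for j
    using that n assms by (intro run_pick_idle) auto
  have pick: "run (pick N m v n ?\<alpha>) (ket (basis N m W False)) =
      (\<lambda>b. complex_of_real (cos ?\<alpha>) * ket (basis N m W False) b +
        (- \<i> * complex_of_real (sin ?\<alpha>)) * ?K n b)"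
    using n assms by (intro run_pick) auto
  have "prep N m v k (Suc n) = prep N m v k n @ pick N m v n ?\<alpha>"
    using step.hyps n by (simp add: prep_def r_def of_nat_diff)
  then have "run (prep N m v k (Suc n)) (ket (basis N m W False)) =
      run (pick N m v n ?\<alpha>) (\<lambda>b. complex_of_real (sqrt (r / d)) * ket (basis N m W False) b +
        (\<Sum>j\<in>{k..<n}. ?c * ?K j b))"
    by (simp only: run_simps(3) step.IH[OF less_imp_le[OF n(1)], folded r_def d_def])
  also have "\<dots> = (\<lambda>b. complex_of_real (sqrt (r / d)) *
        (complex_of_real (cos ?\<alpha>) * ket (basis N m W False) b +
        (- \<i> * complex_of_real (sin ?\<alpha>)) * ?K n b) +
        (\<Sum>j\<in>{k..<n}. ?c * ?K j b))"
    by (simp only: run_lincomb run_sum run_scale idle pick cong: sum.cong)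
  also have "\<dots> = (\<lambda>b. complex_of_real (sqrt ((r - 1) / d)) * ket (basis N m W False) b +
        (?c * ?K n b + (\<Sum>j\<in>{k..<n}. ?c * ?K j b)))"
    unfolding distrib_left mult.assoc[symmetric] c1 c2[unfolded mult.assoc[symmetric]]
    by (simp only: add.assoc)
  finally show ?case
    using step.hyps by (simp add: r1 d_def add.commute fun_upd_def)
qed

lemma run_prep:
  assumes "v < N" "W v = 0" "0 < k" "k < N" "N \<le> 2 ^ m"
  shows "run (prep N m v k N) (ket (basis N m W False)) =
    (\<lambda>b. (- \<i> / complex_of_real (sqrt (real (N - k)))) *
      (\<Sum>j\<in>{k..<N}. ket (basis N m (W(v := j)) False) b))"
  \<comment> \<open>At \<open>n = N\<close> the undecided amplitude is
    \<open>sqrt 0\<close>.\<close>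
  using assms by (subst run_prep_partial) (simp_all add: sum_distrib_left)

section \<open>Redirecting the edge into the inserted index\<close>

text \<open>The ancilla flags the match before register \<open>i\<close> is overwritten by \<open>v\<close>; as \<open>v\<close> is a new value,
  register \<open>i\<close> holding \<open>v\<close> afterwards identifies the flagged states and lets the flag be cleared.\<close>

definition insert_block :: "nat \<Rightarrow> nat \<Rightarrow> nat \<Rightarrow> nat \<Rightarrow> nat \<Rightarrow> gate list" where
  "insert_block N m v i j =
     [MCX (ones m v j \<union> ones m i j) (zeros m v j \<union> zeros m i j) (N * m)] @
     xor_reg N m i (xor j v) @
     [MCX (ones m v j \<union> ones m i v) (zeros m v j \<union> zeros m i v) (N * m)]"

text \<open>Without the last premise, the second comparison could flag a state that the first one
  did not.\<close>

lemma run_insert_block: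
  assumes "v < N" "i < N" "i \<noteq> v" "W v < 2 ^ m" "W i < 2 ^ m" "v < 2 ^ m" "j < 2 ^ m"
    and "\<not> (W v = j \<and> W i = v)"
  shows "run (insert_block N m v i j) (ket (basis N m W False)) =
    ket (basis N m (if W v = j \<and> W i = j then W(i := v) else W) False)"
proof -
  have "xor j (take_bit m (xor j v)) = v"
    using assms(6,7) by (simp add: take_bit_nat_eq_self flip: xor.assoc)
  then show ?thesis
    using assms
    by (auto simp: insert_block_def run_xor_reg apply_MCX_match2 simp del: apply_gate.simps)
qed

text \<open>Among the registers, a block reads only \<open>v\<close> and \<open>i\<close> and
  changes only \<open>i\<close>, so blocks for distinct \<open>i\<close> do not interfere.\<close>

lemma run_insert_row:
  assumes "distinct is" "set is \<subseteq> {..<N} - {v}" "\<forall>i<N. W i < 2 ^ m" "v < N" "v < 2 ^ m"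
    and "j < 2 ^ m" "W v = j \<longrightarrow> (\<forall>i\<in>set is. W i \<noteq> v)"
  shows "run (concat (map (\<lambda>i. insert_block N m v i j) is)) (ket (basis N m W False)) =
    ket (basis N m (\<lambda>i. if i \<in> set is \<and> W v = j \<and> W i = j then v else W i) False)"
  using assms
proof (induction "is" arbitrary: W)
  case (Cons i "is")
  let ?W = "if W v = j \<and> W i = j then W(i := v) else W"
  have "run (insert_block N m v i j) (ket (basis N m W False)) = ket (basis N m ?W False)"
    using Cons.prems by (intro run_insert_block) auto
  moreover have "run (concat (map (\<lambda>i. insert_block N m v i j) is)) (ket (basis N m ?W False)) =
      ket (basis N m (\<lambda>i. if i \<in> set is \<and> ?W v = j \<and> ?W i = j then v else ?W i) False)"
    using Cons.prems by (intro Cons.IH) auto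
  moreover have "(\<lambda>i. if i \<in> set is \<and> ?W v = j \<and> ?W i = j then v else ?W i) =
      (\<lambda>i'. if i' \<in> set (i # is) \<and> W v = j \<and> W i' = j then v else W i')"
    using Cons.prems by (auto simp: fun_eq_iff)
  ultimately show ?case by simp
qed simp

definition insertion :: "nat \<Rightarrow> nat \<Rightarrow> nat \<Rightarrow> nat list \<Rightarrow> nat list \<Rightarrow> gate list" where
  "insertion N m v is js = concat (map (\<lambda>j. concat (map (\<lambda>i. insert_block N m v i j) is)) js)"

text \<open>Register \<open>v\<close> never changes, so only the row with \<open>j = W v\<close> can
  act. As \<open>js\<close> is distinct, the premise about \<open>v\<close> is vacuous for the rows
  after it.\<close>

lemma run_insertion:
  assumes "distinct is" "set is \<subseteq> {..<N} - {v}" "\<forall>i<N. W i < 2 ^ m" "v < N" "v < 2 ^ m"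
    and "distinct js" "set js \<subseteq> {..<2 ^ m}" "W v \<in> set js \<longrightarrow> (\<forall>i\<in>set is. W i \<noteq> v)"
  shows "run (insertion N m v is js) (ket (basis N m W False)) =
    ket (basis N m (\<lambda>i. if i \<in> set is \<and> W v \<in> set js \<and> W i = W v then v else W i) False)"
  using assms
proof (induction js arbitrary: W)
  case Nil
  then show ?case by (simp add: insertion_def)
next
  case (Cons j js)
  let ?W = "\<lambda>i. if i \<in> set is \<and> W v = j \<and> W i = j then v else W i"
  have v: "v \<notin> set is" using Cons.prems by auto
  have "run (concat (map (\<lambda>i. insert_block N m v i j) is)) (ket (basis N m W False)) =
      ket (basis N m ?W False)"
    using Cons.prems by (intro run_insert_row) auto
  moreover have "run (insertion N m v is js) (ket (basis N m ?W False)) =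
      ket (basis N m (\<lambda>i. if i \<in> set is \<and> ?W v \<in> set js \<and> ?W i = ?W v then v else ?W i) False)"
    using Cons.prems v by (intro Cons.IH) auto
  moreover have "(\<lambda>i. if i \<in> set is \<and> ?W v \<in> set js \<and> ?W i = ?W v then v else ?W i) =
      (\<lambda>i. if i \<in> set is \<and> W v \<in> set (j # js) \<and> W i = W v then v else W i)"
    using Cons.prems v by (auto simp: fun_eq_iff)
  ultimately show ?case by (simp add: insertion_def)
qed

section \<open>The stages\<close>

lemma le_two_power_idx_width:
  assumes "0 < N"
  shows "N \<le> 2 ^ idx_width N"
proof -
  have "log 2 (real N) \<le> real (idx_width N)" unfolding idx_width_def by linarith
  then have "real N \<le> 2 powr real (idx_width N)" using assms by (simp add: log_le_iff)
  then have "real N \<le> real (2 ^ idx_width N)" by (simp add: powr_realpow)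
  then show ?thesis by linarith
qed

lemma idx_width_le:
  assumes "0 < N"
  shows "idx_width N \<le> N"
proof -
  have "real N < 2 ^ N" by (rule of_nat_less_two_power)
  then have "log 2 (real N) \<le> real N"
    using assms by (simp add: log_le_iff powr_realpow)
  then show ?thesis by (simp add: idx_width_def ceiling_le_iff)
qed

lemma enc_eq_basis:
  "enc N k \<sigma> = basis N (idx_width N) (\<lambda>i. if k \<le> i then \<sigma> i else 0) False"
  by (auto simp: enc_def basis_def Let_def fun_eq_iff)

definition stage :: "nat \<Rightarrow> nat \<Rightarrow> gate list" where
  "stage N k = prep N (idx_width N) (k - 1) k N @
     insertion N (idx_width N) (k - 1) [k..<N] [k..<N]"

text \<open>Preparation puts \<open>j\<close> into register \<open>k - 1\<close>. The only old
  register holding \<open>j\<close> is that of its predecessor, and overwriting it by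
  \<open>k - 1\<close> completes the insertion. The phase \<open>- \<i>\<close> stems from
  \<open>prep\<close>.\<close>

lemma run_stage:
  assumes k: "0 < k" "k < N" and p: "\<sigma> permutes {k..<N}"
  shows "run (stage N k) (ket (enc N k \<sigma>)) =
    (\<lambda>b. (- \<i> / complex_of_real (sqrt (real (N - k)))) *
      (\<Sum>j\<in>{k..<N}. ket (enc N (k - 1) (ins \<sigma> (k - 1) j)) b))"
proof -
  let ?m = "idx_width N" and ?v = "k - 1"
  let ?W = "\<lambda>i. if k \<le> i then \<sigma> i else 0"
  have N: "N \<le> 2 ^ ?m" using k by (intro le_two_power_idx_width) simp
  have range: "\<sigma> i \<in> {k..<N}" if "i \<in> {k..<N}" for i
    using permutes_in_image[OF p] that by blast
  have ins: "run (insertion N ?m ?v [k..<N] [k..<N]) (ket (basis N ?m (?W(?v := j)) False)) =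
      ket (enc N ?v (ins \<sigma> ?v j))" if j: "j \<in> {k..<N}" for j
  proof -
    let ?W' = "?W(?v := j)"
    have inv: "i = inv \<sigma> j \<longleftrightarrow> \<sigma> i = j" for i using permutes_inverses[OF p] by metis
    have W'v: "?W' ?v = j" by simp
    have W'i: "?W' i = \<sigma> i" if "k \<le> i" for i using that k by auto
    have "\<forall>i<N. ?W' i < 2 ^ ?m" using N range j k by (fastforce intro: less_le_trans)
    moreover have "?v < 2 ^ ?m" "set [k..<N] \<subseteq> {..<2 ^ ?m}" using N k by auto
    \<comment> \<open>On old vertices \<open>\<sigma>\<close> takes values from \<open>k\<close> on,
      so \<open>k - 1\<close> is a new value.\<close>
    moreover have "\<forall>i\<in>set [k..<N]. ?W' i \<noteq> ?v"
    proof
      fix i assume "i \<in> set [k..<N]"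
      then show "?W' i \<noteq> ?v" using range[of i] k by auto
    qed
    ultimately have "run (insertion N ?m ?v [k..<N] [k..<N]) (ket (basis N ?m ?W' False)) =
        ket (basis N ?m (\<lambda>i. if i \<in> set [k..<N] \<and> ?W' ?v \<in> set [k..<N] \<and> ?W' i = ?W' ?v
          then ?v else ?W' i) False)"
      using k by (intro run_insertion) auto
    moreover have "basis N ?m (\<lambda>i. if i \<in> set [k..<N] \<and> ?W' ?v \<in> set [k..<N] \<and> ?W' i = ?W' ?v
          then ?v else ?W' i) False = enc N ?v (ins \<sigma> ?v j)"
      unfolding enc_eq_basis
    proof (rule basis_cong)
      fix i assume i: "i < N"
      \<comment> \<open>The new vertex is a fixed point of \<open>\<sigma>\<close>, so the two
        updates in \<open>ins\<close> concern different arguments.\<close>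
      have "\<sigma> ?v = ?v" using k by (intro permutes_not_in[OF p]) auto
      then have vj: "?v \<noteq> inv \<sigma> j" using inv[of ?v] j k by auto
      consider "i = ?v" | "k \<le> i" | "i < ?v" using k by linarith
      then show "(if i \<in> set [k..<N] \<and> ?W' ?v \<in> set [k..<N] \<and> ?W' i = ?W' ?v then ?v else ?W' i) =
          (if ?v \<le> i then ins \<sigma> ?v j i else 0)"
      proof cases
        case 1
        then show ?thesis using vj k by (auto simp: ins_def)
      next
        case 2
        then show ?thesis unfolding W'i[OF 2] W'v using i j k inv[of i] by (auto simp: ins_def)
      next
        case 3
        then show ?thesis using k by auto
      qed
    qed
    ultimately show ?thesis by simp
  qed
  have "run (stage N k) (ket (enc N k \<sigma>)) = run (insertion N ?m ?v [k..<N] [k..<N])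
      (\<lambda>b. (- \<i> / complex_of_real (sqrt (real (N - k)))) *
        (\<Sum>j\<in>{k..<N}. ket (basis N ?m (?W(?v := j)) False) b))"
    unfolding stage_def enc_eq_basis run_simps(3) using k N by (subst run_prep) auto
  then show ?thesis by (simp only: run_scale run_sum ins cong: sum.cong)
qed

definition init :: "nat \<Rightarrow> gate list" where
  "init N = map (MCX {} {})
     (filter (enc N (N - 2) (transpose (N - 2) (N - 1))) [0..<N * idx_width N])"

text \<open>Qubits from \<open>N * idx_width N\<close> on are 0 in an encoding, so flipping the
  listed ones suffices.\<close>

lemma run_init: "run (init N) (ket (\<lambda>_. False)) = ket (enc N (N - 2) (transpose (N - 2) (N - 1)))"
  unfolding init_def by (subst run_MCX_family_ket) 
    (auto simp: enc_def Let_def intro!: arg_cong[of _ _ ket])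

text \<open>Stage \<open>k\<close> adds vertex \<open>k - 1\<close>, so stages down to
  \<open>Suc p\<close> reach the cycles on \<open>{p..<N}\<close>. Each contributes a phase
  \<open>- \<i>\<close>, and the factors \<open>N - k\<close> multiply to the factorial.\<close>

lemma run_stages:
  assumes "N \<ge> 2" "p \<le> N - 2"
  shows "run (init N @ concat (map (stage N) (rev [Suc p..<N - 1]))) (ket (\<lambda>_. False)) =
    (\<lambda>b. (- \<i>) ^ (N - 2 - p) * (1 / complex_of_real (sqrt (fact (N - 1 - p))) *
      (\<Sum>\<sigma>\<in>hamiltonian_cycles {p..<N}. ket (enc N p \<sigma>) b)))"
  using assms(2)
proof (induction rule: inc_induct)
  case base
  \<comment> \<open>No stage has run yet, and the normaliser is
    \<open>sqrt (fact 1)\<close>.\<close>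
  have "{N - 2..<N} = {N - 2, N - 1}" "Suc (N - 2) = N - 1" "N - 1 - (N - 2) = 1"
    using assms(1) by auto
  then show ?case
    using assms(1) by (simp add: run_init hamiltonian_cycles_pair del: One_nat_def)
next
  case (step p)
  let ?k = "Suc p"
  have p: "?k \<le> N - 2" "?k < N" using step.hyps assms(1) by auto
  let ?a = "(- \<i>) ^ (N - 2 - ?k) * (1 / complex_of_real (sqrt (fact (N - 1 - ?k))))"
  let ?s = "- \<i> / complex_of_real (sqrt (real (N - ?k)))"
  have set: "insert p {?k..<N} = {p..<N}" using p by auto
  have stage: "run (stage N ?k) (ket (enc N ?k \<sigma>)) =
      (\<lambda>b. ?s * (\<Sum>j\<in>{?k..<N}. ket (enc N p (ins \<sigma> p j)) b))"
    if "\<sigma> \<in> hamiltonian_cycles {?k..<N}" for \<sigma>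
    using run_stage[of ?k N \<sigma>] that p by (simp add: hamiltonian_cycles_def)
  \<comment> \<open>By bijectivity of insertion, each larger cycle occurs exactly once in the double
    sum.\<close>
  have reindex: "(\<Sum>\<sigma>\<in>hamiltonian_cycles {?k..<N}. \<Sum>j\<in>{?k..<N}. ket (enc N p (ins \<sigma> p j)) b) =
      (\<Sum>\<sigma>\<in>hamiltonian_cycles {p..<N}. ket (enc N p \<sigma>) b)" for b
    unfolding sum.cartesian_product set[symmetric]
    using p by (subst sum.reindex_bij_betw[OF bij_betw_ins, symmetric]) (auto simp: case_prod_unfold)
  have "rev [?k..<N - 1] = rev [Suc ?k..<N - 1] @ [?k]"
    using p by (subst upt_conv_Cons) auto
  then have "run (init N @ concat (map (stage N) (rev [?k..<N - 1]))) (ket (\<lambda>_. False)) =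
      run (stage N ?k) (\<lambda>b. ?a * (\<Sum>\<sigma>\<in>hamiltonian_cycles {?k..<N}. ket (enc N ?k \<sigma>) b))"
    using step.IH by (simp add: mult.assoc)
  also have "\<dots> = (\<lambda>b. ?a * ?s * (\<Sum>\<sigma>\<in>hamiltonian_cycles {p..<N}. ket (enc N p \<sigma>) b))"
    by (simp only: run_scale run_sum stage sum_distrib_left[symmetric] reindex mult.assoc cong: sum.cong)
  also have "?a * ?s = (- \<i>) ^ (N - 2 - p) * (1 / complex_of_real (sqrt (fact (N - 1 - p))))"
  proof -
    have e: "N - 2 - p = Suc (N - 2 - ?k)" "N - 1 - p = Suc (N - 1 - ?k)" "N - ?k = Suc (N - 1 - ?k)"
      using p by auto
    show ?thesis unfolding e by (simp add: real_sqrt_mult mult_ac)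
  qed
  finally show ?case by (simp only: mult.assoc)
qed

section \<open>Well-formedness and size\<close>

text \<open>A qubit number determines its register and bit position. This keeps the positive and
  negative controls of a comparison disjoint.\<close>

lemma ones_zeros_disjoint:
  assumes "i \<noteq> i' \<or> w = w'"
  shows "ones m i w \<inter> zeros m i' w' = {}"
proof -
  have "i = i' \<and> l = l'" if "i * m + l = i' * m + l'" "l < m" "l' < m" for l l'
    using that by (metis add.commute div_mult_self1 div_less mod_less mod_mult_self1 add_0 not_less0)
  then show ?thesis using assms by (fastforce simp: ones_def zeros_def)
qed

lemma wf_xor_reg:
  assumes "i < N"
  shows "wf_circuit (N * m + 1) (xor_reg N m i w)"
  using qubit_less[OF assms] by (fastforce simp: wf_circuit_def xor_reg_def)

lemma wf_pick:
  assumes "v < N"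
  shows "wf_circuit (N * m + 1) (pick N m v j \<alpha>)"
  using wf_xor_reg[OF assms, of m j] ones_zeros_less[OF assms, of _ m] ones_zeros_disjoint[of v v j j m]
  by (fastforce simp: wf_circuit_def pick_def ctrl_rx_def)

lemma wf_insert_block:
  assumes "v < N" "i < N" "i \<noteq> v"
  shows "wf_circuit (N * m + 1) (insert_block N m v i j)"
proof -
  have "wf_gate (N * m + 1) (MCX (ones m v w \<union> ones m i w') (zeros m v w \<union> zeros m i w') (N * m))"
    for w w'
    using ones_zeros_less[OF assms(1), of _ m] ones_zeros_less[OF assms(2), of _ m]
      ones_zeros_disjoint[of v v w w m] ones_zeros_disjoint[of i i w' w' m]
      ones_zeros_disjoint[of v i w w' m] ones_zeros_disjoint[of i v w' w m] assms(3)
    by (fastforce simp: Int_Un_distrib Int_Un_distrib2)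
  then show ?thesis
    using wf_xor_reg[OF assms(2), of m]
    by (simp add: wf_circuit_def insert_block_def del: wf_gate.simps)
qed

lemma wf_stage:
  assumes "0 < k" "k < N"
  shows "wf_circuit (N * idx_width N + 1) (stage N k)"
proof -
  have "wf_circuit (N * idx_width N + 1) (pick N (idx_width N) (k - 1) j \<alpha>)" for j \<alpha>
    using assms by (intro wf_pick) simp
  moreover have "wf_circuit (N * idx_width N + 1) (insert_block N (idx_width N) (k - 1) i j)"
    if "i \<in> {k..<N}" for i j
    using that assms by (intro wf_insert_block) auto
  ultimately show ?thesis
    by (auto simp: wf_circuit_def stage_def prep_def insertion_def)
qed

section \<open>Gate counts\<close>

lemma length_concat_map_le:
  assumes "\<And>x. x \<in> set xs \<Longrightarrow> length (f x) \<le> c"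
  shows "length (concat (map f xs)) \<le> length xs * c"
  using assms by (induction xs) (auto intro: add_mono)

lemma length_xor_reg: "length (xor_reg N m i w) \<le> m"
  using length_filter_le[of "bit w" "[0..<m]"] by (simp add: xor_reg_def)

text \<open>A pick has six rotation gates, one comparison and at most
  \<open>idx_width N \<le> N\<close> XOR gates; a block has two comparisons and at most
  \<open>N\<close> XOR gates.\<close>

lemma length_stage:
  assumes "k < N"
  shows "length (stage N k) \<le> N * (N + 7) + N * (N * (N + 2))"
proof -
  let ?m = "idx_width N"
  have m: "?m \<le> N" using assms by (intro idx_width_le) simp
  have "length (pick N ?m (k - 1) j \<alpha>) \<le> N + 7" for j \<alpha>
    using length_xor_reg[of N ?m "k - 1" j] m by (simp add: pick_def ctrl_rx_def)
  then have "length (prep N ?m (k - 1) k N) \<le> length [k..<N] * (N + 7)"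
    unfolding prep_def by (intro length_concat_map_le)
  also have "\<dots> \<le> N * (N + 7)" by (intro mult_le_mono1) simp
  finally have prep: "length (prep N ?m (k - 1) k N) \<le> N * (N + 7)" .
  have block: "length (insert_block N ?m (k - 1) i j) \<le> N + 2" for i j
    using length_xor_reg[of N ?m i "xor j (k - 1)"] m by (simp add: insert_block_def)
  have row: "length (concat (map (\<lambda>i. insert_block N ?m (k - 1) i j) [k..<N])) \<le> N * (N + 2)" for j
  proof -
    have "length (concat (map (\<lambda>i. insert_block N ?m (k - 1) i j) [k..<N])) \<le> length [k..<N] * (N + 2)"
      by (intro length_concat_map_le block)
    also have "\<dots> \<le> N * (N + 2)" by (intro mult_le_mono1) simp
    finally show ?thesis .
  qed
  have "length (insertion N ?m (k - 1) [k..<N] [k..<N]) \<le> length [k..<N] * (N * (N + 2))"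
    unfolding insertion_def by (intro length_concat_map_le row)
  also have "\<dots> \<le> N * (N * (N + 2))" by (intro mult_le_mono1) simp
  finally show ?thesis using prep by (simp add: stage_def)
qed

lemma length_circuit:
  assumes "N \<ge> 2"
  shows "length (init N @ concat (map (stage N) (rev [1..<N - 1]))) \<le> 12 * N ^ 4"
proof -
  have "length (init N) \<le> N * idx_width N"
    using length_filter_le[of "enc N (N - 2) (transpose (N - 2) (N - 1))" "[0..<N * idx_width N]"]
    by (simp add: init_def)
  also have "\<dots> \<le> N * N" using assms by (intro mult_le_mono2 idx_width_le) simp
  finally have init: "length (init N) \<le> N * N" .
  have "length (concat (map (stage N) (rev [1..<N - 1]))) \<le>
      length (rev [1..<N - 1]) * (N * (N + 7) + N * (N * (N + 2)))"
    by (intro length_concat_map_le length_stage) auto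
  also have "\<dots> \<le> N * (N * (N + 7) + N * (N * (N + 2)))" by (intro mult_le_mono1) simp
  finally have "length (init N @ concat (map (stage N) (rev [1..<N - 1]))) \<le>
      N ^ 4 + 3 * N ^ 3 + 8 * N ^ 2"
    using init by (simp add: algebra_simps power2_eq_square power3_eq_cube power4_eq_xxxx)
  \<comment> \<open>Raising all powers to the fourth yields the constant 1 + 3 + 8 = 12.\<close>
  also have "\<dots> \<le> N ^ 4 + 3 * N ^ 4 + 8 * N ^ 4"
    using assms by (intro add_mono mult_le_mono2 power_increasing) auto
  finally show ?thesis by simp
qed

theorem theorem2:
  "\<exists>p :: real poly. \<forall>N :: nat. N \<ge> 2 \<longrightarrow>
     (\<exists>(a :: nat) (init :: gate list) (stage :: nat \<Rightarrow> gate list) (circuit :: gate list).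
        circuit = init @ concat (map stage (rev [1..<N - 1])) \<and>
        wf_circuit (N * idx_width N + a) circuit \<and>
        real (length circuit) \<le> poly p (real N) \<and>
        (\<exists>c :: complex. cmod c = 1 \<and>
           run circuit (ket (\<lambda>_. False)) =
             (\<lambda>b. c * (1 / complex_of_real (sqrt (fact (N - 1))) *
                (\<Sum>\<sigma>\<in>hamiltonian_cycles {0..<N}. ket (enc N 0 \<sigma>) b)))) \<and>
        (\<forall>\<sigma>\<in>hamiltonian_cycles {N - 2, N - 1}.
           run init (ket (\<lambda>_. False)) = ket (enc N (N - 2) \<sigma>)) \<and>
        (\<forall>k\<in>{1..N - 2}. \<exists>c :: complex. cmod c = 1 \<and>
           (\<forall>\<sigma>\<in>hamiltonian_cycles {k..<N}.
              run (stage k) (ket (enc N k \<sigma>)) =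
                (\<lambda>b. c * (1 / complex_of_real (sqrt (real (N - k))) *
                   (\<Sum>j\<in>{k..<N}. ket (enc N (k - 1) (ins \<sigma> (k - 1) j)) b))))))"
proof (intro exI[of _ "monom 12 4"] allI impI)
  fix N :: nat
  assume N: "N \<ge> 2"
  let ?circuit = "init N @ concat (map (stage N) (rev [1..<N - 1]))"
  have wf: "wf_circuit (N * idx_width N + 1) ?circuit"
  proof -
    have "wf_circuit (N * idx_width N + 1) (init N)"
      by (auto simp: wf_circuit_def init_def)
    moreover have "wf_circuit (N * idx_width N + 1) (stage N k)" if "k \<in> set [1..<N - 1]" for k
      using that by (intro wf_stage) auto
    ultimately show ?thesis by (auto simp: wf_circuit_def)
  qed
  have size: "real (length ?circuit) \<le> poly (monom 12 4) (real N)"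
  proof -
    have "real (length ?circuit) \<le> real (12 * N ^ 4)"
      using length_circuit[OF N] by (simp only: of_nat_le_iff)
    then show ?thesis by (simp add: poly_monom)
  qed
  have run_all: "\<exists>c :: complex. cmod c = 1 \<and> run ?circuit (ket (\<lambda>_. False)) =
      (\<lambda>b. c * (1 / complex_of_real (sqrt (fact (N - 1))) *
        (\<Sum>\<sigma>\<in>hamiltonian_cycles {0..<N}. ket (enc N 0 \<sigma>) b)))"
    \<comment> \<open>One phase factor \<open>- \<i>\<close> for each of the \<open>N - 2\<close>
      stages.\<close>
    using run_stages[OF N, of 0]
    by (intro exI[of _ "(- \<i>) ^ (N - 2)"]) (simp add: norm_power)
  have run_init': "\<forall>\<sigma>\<in>hamiltonian_cycles {N - 2, N - 1}.
      run (init N) (ket (\<lambda>_. False)) = ket (enc N (N - 2) \<sigma>)"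
    using N by (simp add: hamiltonian_cycles_pair run_init)
  have run_each: "\<forall>k\<in>{1..N - 2}. \<exists>c :: complex. cmod c = 1 \<and>
      (\<forall>\<sigma>\<in>hamiltonian_cycles {k..<N}. run (stage N k) (ket (enc N k \<sigma>)) =
        (\<lambda>b. c * (1 / complex_of_real (sqrt (real (N - k))) *
          (\<Sum>j\<in>{k..<N}. ket (enc N (k - 1) (ins \<sigma> (k - 1) j)) b))))"
    using N by (intro ballI exI[of _ "- \<i>"]) (auto simp: hamiltonian_cycles_def run_stage)
  show "\<exists>a init stage circuit. circuit = init @ concat (map stage (rev [1..<N - 1])) \<and>
        wf_circuit (N * idx_width N + a) circuit \<and>
        real (length circuit) \<le> poly (monom 12 4) (real N) \<and>
        (\<exists>c :: complex. cmod c = 1 \<and>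
           run circuit (ket (\<lambda>_. False)) =
             (\<lambda>b. c * (1 / complex_of_real (sqrt (fact (N - 1))) *
                (\<Sum>\<sigma>\<in>hamiltonian_cycles {0..<N}. ket (enc N 0 \<sigma>) b)))) \<and>
        (\<forall>\<sigma>\<in>hamiltonian_cycles {N - 2, N - 1}.
           run init (ket (\<lambda>_. False)) = ket (enc N (N - 2) \<sigma>)) \<and>
        (\<forall>k\<in>{1..N - 2}. \<exists>c :: complex. cmod c = 1 \<and>
           (\<forall>\<sigma>\<in>hamiltonian_cycles {k..<N}.
              run (stage k) (ket (enc N k \<sigma>)) =
                (\<lambda>b. c * (1 / complex_of_real (sqrt (real (N - k))) *
                   (\<Sum>j\<in>{k..<N}. ket (enc N (k - 1) (ins \<sigma> (k - 1) j)) b)))))"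
    by (intro exI[of _ "1 :: nat"] exI[of _ "init N"] exI[of _ "stage N"] exI[of _ ?circuit]
        conjI refl wf size run_all run_init' run_each)
qed

end
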